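(* Let $\{\Lambda_t\}_{t\ge0}$ be the eternally non-Markovian qubit Pauli dynamics $\Lambda_t[\mathbb{1}]=\mathbb{1}$, $\Lambda_t[\sigma_{j}]=e^{-t}\cosh(t)\,\sigma_{j}$ for $j=1,2$, $\Lambda_t[\sigma_3]=e^{-2t}\sigma_3$. Let $P_2^+$ be the projector onto $\tfrac1{\sqrt2}(|00\rangle+|11\rangle)$. Then superactivation of backflow of information can be witnessed without entanglement: for every $s>0$ there exist separable two-qubit density matrices $\rho_1,\rho_2$, a bias $\mu\in(0,1)$ and $\alpha>0$ such that the Helstrom matrix $\Delta_\mu=\mu\rho_1-(1-\mu)\rho_2$ satisfies $\Lambda_s\otimes\Lambda_s[\Delta_\mu]=\alpha P_2^+$ and, for some $t>s$, $$\big\|\Lambda_t\otimes\Lambda_t[\Delta_\mu]\big\|_1>\big\|\Lambda_s\otimes\Lambda_s[\Delta_\mu]\big\|_1 .$$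
   Context: $\sigma_1,\sigma_2,\sigma_3$ are the Pauli matrices and $\|X\|_1=\mathrm{Tr}\sqrt{X^\dagger X}$ is the trace norm. The family $\Lambda_t$ is the one generated by $\mathcal{L}_t[\rho]=\tfrac12\sum_{i=1}^3\gamma_t^{(i)}(\sigma_i\rho\sigma_i-\rho)$ with rates $\gamma_t^{(1)}=\gamma_t^{(2)}=1$, $\gamma_t^{(3)}=-\tanh(t)$. It is P-divisible, i.e. $\Lambda_t=\Lambda_{t,s}\circ\Lambda_s$ with $\Lambda_{t,s}$ positive and trace preserving for all $t\ge s\ge0$, so that a single qubit shows no backflow of information (no increase in time of the trace norm of an evolving Helstrom matrix); "superactivation of backflow of information" means that such an increase occurs for $\Lambda_t\otimes\Lambda_t$. *)

theory Defs
  imports "HOL-Analysis.Analysis"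
begin

text \<open>A qubit is indexed by the numeral type \<open>2\<close>, with \<open>|0\<rangle>\<close> the basis vector \<open>axis 1 1\<close>
  and \<open>|1\<rangle>\<close> the basis vector \<open>axis 2 1\<close>; a two-qubit system is indexed by pairs.\<close>

type_synonym 'n cmat = "complex^'n^'n"

definition cscale :: "complex \<Rightarrow> 'n::finite cmat \<Rightarrow> 'n cmat" where
  "cscale c A = (\<chi> i j. c * A $ i $ j)"

definition dagger :: "'n::finite cmat \<Rightarrow> 'n cmat" where
  "dagger A = (\<chi> i j. cnj (A $ j $ i))"

abbreviation clinear_map :: "('n::finite cmat \<Rightarrow> 'm::finite cmat) \<Rightarrow> bool" where
  "clinear_map \<equiv> Vector_Spaces.linear cscale cscale"

definition pauli1 :: "2 cmat" where
  "pauli1 = vector [vector [0, 1], vector [1, 0]]"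

definition pauli2 :: "2 cmat" where
  "pauli2 = vector [vector [0, - \<i>], vector [\<i>, 0]]"

definition pauli3 :: "2 cmat" where
  "pauli3 = vector [vector [1, 0], vector [0, - 1]]"

definition possemidef :: "'n::finite cmat \<Rightarrow> bool" where
  "possemidef A \<longleftrightarrow>
     dagger A = A \<and> (\<forall>v. 0 \<le> Re (\<Sum>i\<in>UNIV. cnj (v $ i) * (A *v v) $ i))"

text \<open>The positive semidefinite square root exists and is unique when \<open>A\<close> is positive
  semidefinite; the value is unspecified otherwise.\<close>

definition matrix_sqrt :: "'n::finite cmat \<Rightarrow> 'n cmat" where
  "matrix_sqrt A = (THE B. possemidef B \<and> B ** B = A)"

definition trace_norm :: "'n::finite cmat \<Rightarrow> real" where
  "trace_norm X = Re (trace (matrix_sqrt (dagger X ** X)))"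

definition density_matrix :: "'n::finite cmat \<Rightarrow> bool" where
  "density_matrix \<rho> \<longleftrightarrow> possemidef \<rho> \<and> trace \<rho> = 1"

definition kron :: "'a::finite cmat \<Rightarrow> 'b::finite cmat \<Rightarrow> ('a \<times> 'b) cmat" where
  "kron A B = (\<chi> p q. A $ fst p $ fst q * B $ snd p $ snd q)"

definition matrix_unit :: "'n::finite \<Rightarrow> 'n \<Rightarrow> 'n cmat" where
  "matrix_unit k l = (\<chi> i j. if i = k \<and> j = l then 1 else 0)"

text \<open>The tensor product \<open>\<Phi> \<otimes> \<Psi>\<close> of two maps, obtained by expanding the argument in the
  basis \<open>kron (matrix_unit i k) (matrix_unit j l)\<close>.\<close>

definition tensor_map ::
  "('a::finite cmat \<Rightarrow> 'a cmat) \<Rightarrow> ('b::finite cmat \<Rightarrow> 'b cmat) \<Rightarrow> ('a \<times> 'b) cmat \<Rightarrow> ('a \<times> 'b) cmat"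
  where
  "tensor_map \<Phi> \<Psi> X =
     (\<Sum>i\<in>UNIV. \<Sum>j\<in>UNIV. \<Sum>k\<in>UNIV. \<Sum>l\<in>UNIV.
        cscale (X $ (i, j) $ (k, l)) (kron (\<Phi> (matrix_unit i k)) (\<Psi> (matrix_unit j l))))"

definition separable :: "('a::finite \<times> 'b::finite) cmat \<Rightarrow> bool" where
  "separable \<rho> \<longleftrightarrow>
     (\<exists>(n::nat) (p::nat \<Rightarrow> real) A B.
        (\<forall>k<n. 0 \<le> p k \<and> density_matrix (A k) \<and> density_matrix (B k)) \<and>
        (\<Sum>k<n. p k) = 1 \<and>
        \<rho> = (\<Sum>k<n. p k *\<^sub>R kron (A k) (B k)))"

definition bell_vector :: "complex^(2 \<times> 2)" where
  "bell_vector = (1 / sqrt 2) *\<^sub>R (axis (1, 1) 1 + axis (2, 2) 1)"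

definition P2plus :: "(2 \<times> 2) cmat" where
  "P2plus = (\<chi> i j. bell_vector $ i * cnj (bell_vector $ j))"

definition helstrom :: "real \<Rightarrow> 'n::finite cmat \<Rightarrow> 'n cmat \<Rightarrow> 'n cmat" where
  "helstrom \<mu> \<rho>1 \<rho>2 = \<mu> *\<^sub>R \<rho>1 - (1 - \<mu>) *\<^sub>R \<rho>2"

definition eternal_pauli_dynamics :: "(real \<Rightarrow> 2 cmat \<Rightarrow> 2 cmat) \<Rightarrow> bool" where
  "eternal_pauli_dynamics \<Lambda> \<longleftrightarrow>
     (\<forall>t\<ge>0. clinear_map (\<Lambda> t) \<and>
        \<Lambda> t (mat 1) = mat 1 \<and>
        \<Lambda> t pauli1 = (exp (- t) * cosh t) *\<^sub>R pauli1 \<and>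
        \<Lambda> t pauli2 = (exp (- t) * cosh t) *\<^sub>R pauli2 \<and>
        \<Lambda> t pauli3 = exp (- 2 * t) *\<^sub>R pauli3)"

lemma vector_space_cscale: "vector_space cscale"
  by unfold_locales (simp_all add: cscale_def vec_eq_iff algebra_simps)

lemma clinear_map_iff:
  "clinear_map f \<longleftrightarrow>
     (\<forall>X Y. f (X + Y) = f X + f Y) \<and> (\<forall>c X. f (cscale c X) = cscale c (f X))"
  by (simp add: Vector_Spaces.linear_iff vector_space_cscale)

lemma matrix_unit_expansion:
  "A = (\<Sum>i\<in>UNIV. \<Sum>k\<in>UNIV. cscale (A $ i $ k) (matrix_unit i k))"
proof -
  have "(\<Sum>i\<in>UNIV. \<Sum>k\<in>UNIV. A $ i $ k * (if a = i \<and> b = k then 1 else 0)) = A $ a $ b" for a b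
  proof -
    have "(\<Sum>i\<in>UNIV. \<Sum>k\<in>UNIV. A $ i $ k * (if a = i \<and> b = k then 1 else 0))
      = (\<Sum>i\<in>UNIV. if a = i then (\<Sum>k\<in>UNIV. if b = k then A $ i $ k else 0) else 0)"
      by (intro sum.cong refl) (simp add: if_distrib cong: if_cong)
    then show ?thesis by simp
  qed
  then show ?thesis
    by (simp add: vec_eq_iff cscale_def matrix_unit_def)
qed

lemma clinear_map_expansion:
  assumes "clinear_map f"
  shows "f A = (\<Sum>i\<in>UNIV. \<Sum>k\<in>UNIV. cscale (A $ i $ k) (f (matrix_unit i k)))"
proof -
  interpret Vector_Spaces.linear cscale cscale f by (rule assms)
  show ?thesis
    by (subst matrix_unit_expansion[of A]) (simp only: sum scale)
qed

lemma tensor_map_kron: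
  assumes "clinear_map \<Phi>" "clinear_map \<Psi>"
  shows "tensor_map \<Phi> \<Psi> (kron A B) = kron (\<Phi> A) (\<Psi> B)"
proof -
  have "tensor_map \<Phi> \<Psi> (kron A B) $ p $ q = kron (\<Phi> A) (\<Psi> B) $ p $ q" for p q
  proof -
    have eA: "\<Phi> A $ a $ b = (\<Sum>i\<in>UNIV. \<Sum>k\<in>UNIV. A $ i $ k * \<Phi> (matrix_unit i k) $ a $ b)" for a b
      using arg_cong[OF clinear_map_expansion[OF assms(1), of A], of "\<lambda>M. M $ a $ b"]
      by (simp add: cscale_def)
    have eB: "\<Psi> B $ a $ b = (\<Sum>j\<in>UNIV. \<Sum>l\<in>UNIV. B $ j $ l * \<Psi> (matrix_unit j l) $ a $ b)" for a b
      using arg_cong[OF clinear_map_expansion[OF assms(2), of B], of "\<lambda>M. M $ a $ b"]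
      by (simp add: cscale_def)
    show ?thesis
      unfolding tensor_map_def
      by (simp add: kron_def cscale_def eA eB sum_product ac_simps)
  qed
  then show ?thesis by (simp add: vec_eq_iff)
qed

lemma eternal_pauli_dynamics_exists: "\<exists>\<Lambda>. eternal_pauli_dynamics \<Lambda>"
proof -
  define \<Lambda> :: "real \<Rightarrow> 2 cmat \<Rightarrow> 2 cmat" where
    "\<Lambda> t X =
       cscale ((X $ 1 $ 1 + X $ 2 $ 2) / 2) (mat 1) +
       cscale (of_real (exp (- t) * cosh t) * (X $ 1 $ 2 + X $ 2 $ 1) / 2) pauli1 +
       cscale (of_real (exp (- t) * cosh t) * \<i> * (X $ 1 $ 2 - X $ 2 $ 1) / 2) pauli2 +
       cscale (of_real (exp (- 2 * t)) * (X $ 1 $ 1 - X $ 2 $ 2) / 2) pauli3" for t X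
  have "clinear_map (\<Lambda> t)" for t
    by (simp add: clinear_map_iff \<Lambda>_def cscale_def vec_eq_iff algebra_simps
        add_divide_distrib diff_divide_distrib)
  then have "eternal_pauli_dynamics \<Lambda>"
    unfolding eternal_pauli_dynamics_def
    by (auto simp: \<Lambda>_def cscale_def vec_eq_iff forall_2 pauli1_def pauli2_def pauli3_def mat_def
        scaleR_conv_of_real[where 'a=complex])
  then show ?thesis by (rule exI[where x = \<Lambda>])
qed

end

(* Write \<lambda>(t) = exp(-t) cosh(t), \<kappa>(t) = exp(-2t). Since P_2^+ = (1 + s1 s1 - s2 s2 + s3 s3) / 4, the
   operator mapped to \<alpha> P_2^+ at time s is \<alpha> (1 + a (s1 s1 - s2 s2) + b s3 s3) / 4 with
   a = 1/\<lambda>(s)^2 and b = 1/\<kappa>(s)^2. Each of 1 + s1 s1, 1 - s2 s2, 1 + s3 s3 is a sum of product states,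
   so this operator is a positive multiple of a separable state minus a positive multiple of the
   maximally mixed state. At time t its eigenvalue on (|00> - |11>)/sqrt 2 is \<alpha> (1 - 2 x + z) / 4,
   where x = (\<lambda>(t)/\<lambda>(s))^2 and z = (\<kappa>(t)/\<kappa>(s))^2. This is negative for t slightly larger than s,
   while the trace stays equal to \<alpha>, so the trace norm exceeds \<alpha>. *)

theory Submission
  imports Defs
begin

section \<open>Sums over index pairs and the Hermitian inner product\<close>

lemma sum_prod_2:
  fixes f :: "2 \<times> 2 \<Rightarrow> 'a::comm_monoid_add"
  shows "sum f UNIV = f (1, 1) + f (1, 2) + (f (2, 1) + f (2, 2))"
proof -
  have "sum f UNIV = (\<Sum>i\<in>UNIV. \<Sum>j\<in>UNIV. f (i, j))"
    by (simp add: sum.cartesian_product)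
  then show ?thesis by (simp add: sum_2)
qed

lemma forall_prod_2: "(\<forall>p :: 2 \<times> 2. P p) \<longleftrightarrow> P (1, 1) \<and> P (1, 2) \<and> P (2, 1) \<and> P (2, 2)"
  by (simp add: forall_2)

definition cdot :: "complex^'n \<Rightarrow> complex^'n::finite \<Rightarrow> complex" where
  "cdot v w = (\<Sum>i\<in>UNIV. cnj (v $ i) * w $ i)"

lemma cdot_add_left: "cdot (u + v) w = cdot u w + cdot v w"
  by (simp add: cdot_def algebra_simps sum.distrib)

lemma cdot_add_right: "cdot w (u + v) = cdot w u + cdot w v"
  by (simp add: cdot_def algebra_simps sum.distrib)

lemma cdot_scaleR_left: "cdot (r *\<^sub>R v) w = r *\<^sub>R cdot v w"
  by (simp add: cdot_def scaleR_sum_right)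

lemma cdot_scaleR_right: "cdot v (r *\<^sub>R w) = r *\<^sub>R cdot v w"
  by (simp add: cdot_def scaleR_sum_right)

lemma Re_cdot_self: "Re (cdot v v) = (\<Sum>i\<in>UNIV. (cmod (v $ i))\<^sup>2)"
  by (simp add: cdot_def cmod_power2 flip: power2_eq_square)

lemma Re_cdot_self_nonneg: "0 \<le> Re (cdot v v)"
  by (simp add: Re_cdot_self sum_nonneg)

lemma Re_cdot_self_eq_0_iff: "Re (cdot v v) = 0 \<longleftrightarrow> v = 0"
  by (simp add: Re_cdot_self sum_nonneg_eq_0_iff vec_eq_iff)

lemma cdot_axis_left: "cdot (axis i 1) v = v $ i"
  by (simp add: cdot_def axis_def if_distrib[of cnj] if_distrib[of "\<lambda>x. x * _"] cong: if_cong)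

lemma matrix_vector_mult_axis: "(A *v axis k 1) $ i = (A :: complex^'n^'m) $ i $ k"
  by (simp add: matrix_vector_mult_def axis_def if_distrib[of "\<lambda>x. _ * x"] cong: if_cong)

lemma cdot_dagger: "cdot v (A *v w) = cdot (dagger A *v v) w"
proof -
  have "cdot v (A *v w) = (\<Sum>i\<in>UNIV. \<Sum>j\<in>UNIV. cnj (v $ i) * (A $ i $ j * w $ j))"
    by (simp add: cdot_def matrix_vector_mult_def sum_distrib_left)
  also have "\<dots> = (\<Sum>j\<in>UNIV. \<Sum>i\<in>UNIV. cnj (v $ i) * (A $ i $ j * w $ j))"
    by (rule sum.swap)
  also have "\<dots> = cdot (dagger A *v v) w"
    by (simp add: cdot_def matrix_vector_mult_def dagger_def sum_distrib_right sum_distrib_left ac_simps)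
  finally show ?thesis .
qed

section \<open>Positive semidefinite matrices and their square roots\<close>

lemma possemidef_iff: "possemidef A \<longleftrightarrow> dagger A = A \<and> (\<forall>v. 0 \<le> Re (cdot v (A *v v)))"
  by (simp add: possemidef_def cdot_def)

lemma possemidef_hermitian_square:
  assumes "dagger C = C"
  shows "possemidef (C ** C)"
proof -
  have "dagger (C ** C) = dagger C ** dagger C"
    by (simp add: dagger_def matrix_matrix_mult_def vec_eq_iff ac_simps)
  moreover have "cdot v ((C ** C) *v v) = cdot (C *v v) (C *v v)" for v
    by (simp add: matrix_vector_mul_assoc[symmetric] cdot_dagger[of v C] assms)
  ultimately show ?thesis
    by (simp add: possemidef_iff assms Re_cdot_self_nonneg)
qed

text \<open>Moving from \<open>w\<close> in the direction \<open>A *v w\<close> changes the form by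
  \<open>2 * r * n + r^2 * m\<close>, with \<open>n\<close> the squared length of
  \<open>A *v w\<close>. A linear term that never makes this negative must vanish.\<close>

lemma possemidef_kernel:
  assumes "possemidef A" and "Re (cdot w (A *v w)) = 0"
  shows "A *v w = 0"
proof -
  have dA: "dagger A = A" using assms(1) by (simp add: possemidef_iff)
  define n where "n = Re (cdot (A *v w) (A *v w))"
  define m where "m = Re (cdot (A *v w) (A *v (A *v w)))"
  have m: "0 \<le> m" using assms(1) by (simp add: possemidef_iff m_def)
  have n: "0 \<le> n" by (simp add: n_def Re_cdot_self_nonneg)
  have *: "0 \<le> 2 * r * n + r\<^sup>2 * m" for r :: real
  proof -
    have "Re (cdot (w + r *\<^sub>R (A *v w)) (A *v (w + r *\<^sub>R (A *v w)))) = 2 * r * n + r\<^sup>2 * m"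
    proof -
      have sc: "A *v (r *\<^sub>R v) = r *\<^sub>R (A *v v)" for v
        by (simp add: matrix_vector_mult_def vec_eq_iff scaleR_sum_right)
      have "cdot w (A *v (A *v w)) = cdot (A *v w) (A *v w)"
        by (simp add: cdot_dagger[of w A "A *v w"] dA)
      then show ?thesis
        using assms(2)
        by (simp add: matrix_vector_right_distrib sc cdot_add_left cdot_add_right
            cdot_scaleR_left cdot_scaleR_right n_def m_def power2_eq_square algebra_simps)
    qed
    then show ?thesis using assms(1) by (metis possemidef_iff)
  qed
  have "n = 0"
  proof (rule ccontr)
    assume "n \<noteq> 0"
    then have "n > 0" using n by simp
    \<comment> \<open>The choice \<open>r = - n / (m + 1)\<close> makes the linear term dominate;
      the \<open>+ 1\<close> keeps the denominator positive when \<open>m = 0\<close>.\<close>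
    have "2 * (- n / (m + 1)) * n + (- n / (m + 1))\<^sup>2 * m = - (n\<^sup>2 * (m + 2)) / (m + 1)\<^sup>2"
      using m by (simp add: divide_simps power2_eq_square) (simp add: algebra_simps)
    moreover have "\<dots> < 0"
      using m \<open>n > 0\<close> by (simp add: divide_neg_pos)
    ultimately show False using *[of "- n / (m + 1)"] by simp
  qed
  then show ?thesis by (simp add: n_def Re_cdot_self_eq_0_iff)
qed

text \<open>With \<open>C = A - B\<close>, the hypothesis gives \<open>AC + CB = 0\<close>, so \<open>CAC\<close> and \<open>CBC\<close> have
  opposite traces. Both are positive semidefinite, hence \<open>AC = BC = 0\<close> and \<open>C\<^sup>2 = 0\<close>.\<close>

lemma possemidef_sqrt_unique:
  fixes A B :: "'n::finite cmat"
  assumes A: "possemidef A" and B: "possemidef B" and eq: "A ** A = B ** B"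
  shows "A = B"
proof -
  define C where "C = A - B"
  have dC: "dagger C = C"
    using A B by (simp add: possemidef_iff C_def dagger_def vec_eq_iff)
  have psA: "0 \<le> Re (cdot v (A *v v))" and psB: "0 \<le> Re (cdot v (B *v v))" for v
    using A B by (simp_all add: possemidef_iff)
  have AB: "A ** C + C ** B = 0"
  proof -
    have "A ** A = A ** C + A ** B"
      by (simp add: C_def flip: matrix_add_ldistrib)
    also have "A ** B = C ** B + B ** B"
      by (simp add: C_def matrix_matrix_mult_def vec_eq_iff left_diff_distrib sum_subtractf)
    finally show ?thesis by (simp add: eq)
  qed
  \<comment> \<open>For Hermitian \<open>C\<close> the trace of \<open>CMC\<close> is the form of
    \<open>M\<close> summed over the columns of \<open>C\<close>. If it vanishes for semidefinite
    \<open>M\<close>, every summand does, and \<open>possemidef_kernel\<close> applies.\<close>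
  have tr: "Re (trace (C ** (M ** C))) = (\<Sum>i\<in>UNIV. Re (cdot (C *v axis i 1) (M *v (C *v axis i 1))))"
    for M
  proof -
    have "cdot (C *v axis i 1) (M *v (C *v axis i 1)) = (C ** (M ** C)) $ i $ i" for i
    proof -
      have "cdot (C *v axis i 1) (M *v (C *v axis i 1)) = cdot (axis i 1) ((C ** (M ** C)) *v axis i 1)"
        by (simp add: matrix_vector_mul_assoc[symmetric] cdot_dagger[of _ C] dC)
      also have "\<dots> = (C ** (M ** C)) $ i $ i"
        by (simp add: cdot_axis_left matrix_vector_mult_axis)
      finally show ?thesis .
    qed
    then show ?thesis by (simp add: trace_def)
  qed
  \<comment> \<open>Cyclicity turns \<open>CBC\<close> into \<open>CCB\<close>, which exposes the
    factor \<open>AC + CB = 0\<close>.\<close>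
  have "trace (C ** (A ** C)) + trace (C ** (B ** C)) = trace (C ** (A ** C)) + trace (C ** (C ** B))"
    using trace_mul_sym[of C "B ** C"] trace_mul_sym[of "C ** C" B]
    by (simp add: matrix_mul_assoc)
  also have "\<dots> = trace (C ** (A ** C + C ** B))"
    by (simp add: matrix_add_ldistrib trace_add)
  also have "\<dots> = 0" unfolding AB by (simp add: matrix_matrix_mult_def trace_def)
  finally have "Re (trace (C ** (A ** C))) + Re (trace (C ** (B ** C))) = 0"
    by (metis plus_complex.sel(1) zero_complex.sel(1))
  then have "(\<Sum>i\<in>UNIV. Re (cdot (C *v axis i 1) (A *v (C *v axis i 1)))) = 0"
    and "(\<Sum>i\<in>UNIV. Re (cdot (C *v axis i 1) (B *v (C *v axis i 1)))) = 0"
    unfolding tr by (simp_all add: add_nonneg_eq_0_iff sum_nonneg psA psB)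
  then have "A *v (C *v axis i 1) = 0" and "B *v (C *v axis i 1) = 0" for i
    using possemidef_kernel[OF A] possemidef_kernel[OF B]
    by (simp_all add: sum_nonneg_eq_0_iff psA psB)
  then have "C *v (C *v axis i 1) = 0" for i
    by (simp add: C_def matrix_vector_mult_diff_rdistrib)
  then have "cdot (C *v axis i 1) (C *v axis i 1) = 0" for i
    using cdot_dagger[of "axis i 1" C "C *v axis i 1"] by (simp add: dC cdot_axis_left)
  then have "C *v axis i 1 = 0" for i
    by (simp flip: Re_cdot_self_eq_0_iff)
  then have "C $ j $ i = 0" for i j
    by (metis matrix_vector_mult_axis zero_index)
  then have "C = 0"
    by (simp add: vec_eq_iff)
  then show ?thesis by (simp add: C_def)
qed

text \<open>Uniqueness of the square root resolves the definite description, so a trace norm is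
  computed by exhibiting one semidefinite root.\<close>

lemma trace_norm_eqI:
  assumes "possemidef B" "B ** B = dagger X ** X"
  shows "trace_norm X = Re (trace B)"
proof -
  have "matrix_sqrt (dagger X ** X) = B"
    unfolding matrix_sqrt_def
    by (rule the_equality) (use assms in \<open>auto intro: possemidef_sqrt_unique\<close>)
  then show ?thesis by (simp add: trace_norm_def)
qed

section \<open>X-shaped two-qubit matrices\<close>

text \<open>In the ordered basis \<open>(1,1), (1,2), (2,1), (2,2)\<close> this is the X-shaped matrix with
  diagonal \<open>p, r, r, p\<close> and \<open>q\<close> in the two outer corners.\<close>

definition xmat :: "real \<Rightarrow> real \<Rightarrow> real \<Rightarrow> (2 \<times> 2) cmat" where
  "xmat p q r = ((p + r) / 2) *\<^sub>R kron (mat 1) (mat 1)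
     + (q / 2) *\<^sub>R kron pauli1 pauli1 - (q / 2) *\<^sub>R kron pauli2 pauli2
     + ((p - r) / 2) *\<^sub>R kron pauli3 pauli3"

lemma xmat_nth [simp]:
  "xmat p q r $ (1, 1) $ (1, 1) = p" "xmat p q r $ (1, 1) $ (1, 2) = 0"
  "xmat p q r $ (1, 1) $ (2, 1) = 0" "xmat p q r $ (1, 1) $ (2, 2) = q"
  "xmat p q r $ (1, 2) $ (1, 1) = 0" "xmat p q r $ (1, 2) $ (1, 2) = r"
  "xmat p q r $ (1, 2) $ (2, 1) = 0" "xmat p q r $ (1, 2) $ (2, 2) = 0"
  "xmat p q r $ (2, 1) $ (1, 1) = 0" "xmat p q r $ (2, 1) $ (1, 2) = 0"
  "xmat p q r $ (2, 1) $ (2, 1) = r" "xmat p q r $ (2, 1) $ (2, 2) = 0"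
  "xmat p q r $ (2, 2) $ (1, 1) = q" "xmat p q r $ (2, 2) $ (1, 2) = 0"
  "xmat p q r $ (2, 2) $ (2, 1) = 0" "xmat p q r $ (2, 2) $ (2, 2) = p"
  by (simp_all add: xmat_def kron_def mat_def pauli1_def pauli2_def pauli3_def complex_eq_iff field_simps)

lemma dagger_xmat: "dagger (xmat p q r) = xmat p q r"
  unfolding vec_eq_iff forall_prod_2 by (simp add: dagger_def)

lemma xmat_square: "xmat p q r ** xmat p q r = xmat (p\<^sup>2 + q\<^sup>2) (2 * p * q) (r\<^sup>2)"
  unfolding vec_eq_iff forall_prod_2 by (simp add: matrix_matrix_mult_def sum_prod_2 power2_eq_square)

lemma trace_xmat: "trace (xmat p q r) = 2 * p + 2 * r"
  by (simp add: trace_def sum_prod_2)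

text \<open>The form is diagonal along \<open>|00> + |11>\<close>, \<open>|00> - |11>\<close>,
  \<open>|01>\<close> and \<open>|10>\<close>, with eigenvalues \<open>p + q\<close>,
  \<open>p - q\<close>, \<open>r\<close> and \<open>r\<close>.\<close>

lemma possemidef_xmat:
  assumes "\<bar>q\<bar> \<le> p" "0 \<le> r"
  shows "possemidef (xmat p q r)"
proof -
  have "0 \<le> Re (cdot v (xmat p q r *v v))" for v
  proof -
    define a b c d where "a = v $ (1, 1)" and "b = v $ (1, 2)" and "c = v $ (2, 1)" and "d = v $ (2, 2)"
    have "Re (cdot v (xmat p q r *v v)) =
      (p + q) / 2 * (cmod (a + d))\<^sup>2 + (p - q) / 2 * (cmod (a - d))\<^sup>2
        + r * (cmod b)\<^sup>2 + r * (cmod c)\<^sup>2"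
      unfolding cmod_power2
      by (simp add: cdot_def matrix_vector_mult_def sum_prod_2 a_def b_def c_def d_def
          power2_eq_square field_simps)
    then show ?thesis using assms by simp
  qed
  then show ?thesis by (simp add: possemidef_iff dagger_xmat)
qed

text \<open>The eigenvalues are \<open>p + q\<close>, \<open>p - q \<le> 0\<close> and twice \<open>r\<close>, so the modulus of the matrix
  arises by interchanging \<open>p\<close> and \<open>q\<close>.\<close>

lemma trace_norm_xmat:
  assumes "\<bar>p\<bar> \<le> q" "0 \<le> r"
  shows "trace_norm (xmat p q r) = 2 * q + 2 * r"
proof -
  have "xmat q p r ** xmat q p r = dagger (xmat p q r) ** xmat p q r"
    by (simp add: dagger_xmat xmat_square ac_simps)
  from trace_norm_eqI[OF possemidef_xmat[OF assms] this] show ?thesis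
    by (simp add: trace_xmat)
qed

lemma P2plus_eq_xmat: "P2plus = xmat (1 / 2) (1 / 2) 0"
proof -
  have [simp]: "complex_of_real (sqrt 2) * complex_of_real (sqrt 2) = 2"
    by (simp flip: of_real_mult)
  show ?thesis
    unfolding vec_eq_iff forall_prod_2 by (simp add: P2plus_def bell_vector_def axis_def
        scaleR_conv_of_real[where 'a=complex])
qed

lemma scaleR_xmat: "c *\<^sub>R xmat p q r = xmat (c * p) (c * q) (c * r)"
  unfolding vec_eq_iff forall_prod_2 by (simp add: scaleR_conv_of_real[where 'a=complex])

lemma xmat_diff: "xmat p q r - xmat p' q' r' = xmat (p - p') (q - q') (r - r')"
  unfolding vec_eq_iff forall_prod_2 by simp

section \<open>Tensor products of Pauli maps\<close>

lemma tensor_map_add: "tensor_map \<Phi> \<Psi> (X + Y) = tensor_map \<Phi> \<Psi> X + tensor_map \<Phi> \<Psi> Y"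
  by (simp add: tensor_map_def vec_eq_iff cscale_def algebra_simps sum.distrib)

lemma tensor_map_scaleR: "tensor_map \<Phi> \<Psi> (c *\<^sub>R X) = c *\<^sub>R tensor_map \<Phi> \<Psi> X"
  by (simp add: tensor_map_def vec_eq_iff cscale_def scaleR_sum_right)

lemma tensor_map_diff: "tensor_map \<Phi> \<Psi> (X - Y) = tensor_map \<Phi> \<Psi> X - tensor_map \<Phi> \<Psi> Y"
  by (metis add_diff_cancel diff_add_cancel tensor_map_add)

lemma kron_scaleR: "kron (c *\<^sub>R A) (d *\<^sub>R B) = (c * d) *\<^sub>R kron A B"
  by (simp add: kron_def vec_eq_iff)

text \<open>Each Pauli pair in \<open>xmat\<close> is an eigenoperator: the identity part is fixed,
  the corners shrink by \<open>l^2\<close> and the diagonal difference \<open>p - r\<close> by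
  \<open>k^2\<close>.\<close>

lemma tensor_map_xmat:
  assumes "clinear_map \<Phi>" "\<Phi> (mat 1) = mat 1" "\<Phi> pauli1 = l *\<^sub>R pauli1"
    "\<Phi> pauli2 = l *\<^sub>R pauli2" "\<Phi> pauli3 = k *\<^sub>R pauli3"
  shows "tensor_map \<Phi> \<Phi> (xmat p q r) =
    xmat ((p + r + k\<^sup>2 * (p - r)) / 2) (l\<^sup>2 * q) ((p + r - k\<^sup>2 * (p - r)) / 2)"
proof -
  define p' where "p' = (p + r + k\<^sup>2 * (p - r)) / 2"
  define r' where "r' = (p + r - k\<^sup>2 * (p - r)) / 2"
  have "(p' + r') / 2 = (p + r) / 2" "(p' - r') / 2 = (p - r) * (k * k) / 2"
    by (simp_all add: p'_def r'_def power2_eq_square field_simps)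
  then have "xmat p' (l\<^sup>2 * q) r' = ((p + r) / 2) *\<^sub>R kron (mat 1) (mat 1)
      + (l\<^sup>2 * q / 2) *\<^sub>R kron pauli1 pauli1 - (l\<^sup>2 * q / 2) *\<^sub>R kron pauli2 pauli2
      + ((p - r) * (k * k) / 2) *\<^sub>R kron pauli3 pauli3"
    by (simp only: xmat_def)
  then show ?thesis
    unfolding p'_def[symmetric] r'_def[symmetric]
    by (simp add: xmat_def tensor_map_add tensor_map_diff tensor_map_scaleR
        tensor_map_kron assms kron_scaleR power2_eq_square mult.commute)
qed

section \<open>Qubit states and separable mixtures\<close>

definition bloch :: "real \<Rightarrow> real \<Rightarrow> real \<Rightarrow> 2 cmat" where
  "bloch x y z = (1 / 2) *\<^sub>R (mat 1 + x *\<^sub>R pauli1 + y *\<^sub>R pauli2 + z *\<^sub>R pauli3)"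

lemma bloch_nth:
  "bloch x y z $ 1 $ 1 = (1 + z) / 2" "bloch x y z $ 1 $ 2 = (x - \<i> * y) / 2"
  "bloch x y z $ 2 $ 1 = (x + \<i> * y) / 2" "bloch x y z $ 2 $ 2 = (1 - z) / 2"
  by (simp_all add: bloch_def mat_def pauli1_def pauli2_def pauli3_def complex_eq_iff)

text \<open>A unit Bloch vector gives a Hermitian idempotent, which equals its own square and is
  therefore semidefinite.\<close>

lemma density_matrix_bloch:
  assumes "x\<^sup>2 + y\<^sup>2 + z\<^sup>2 = 1"
  shows "density_matrix (bloch x y z)"
proof -
  have "dagger (bloch x y z) = bloch x y z"
    by (simp add: dagger_def vec_eq_iff forall_2 bloch_nth)
  moreover have "bloch x y z ** bloch x y z = bloch x y z"
    using assms
    by (simp add: matrix_matrix_mult_def vec_eq_iff forall_2 sum_2 bloch_nth complex_eq_iff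
        power2_eq_square field_simps)
  ultimately have "possemidef (bloch x y z)"
    using possemidef_hermitian_square by metis
  then show ?thesis
    by (simp add: density_matrix_def trace_def sum_2 bloch_nth field_simps)
qed

lemma density_matrix_maximally_mixed: "density_matrix (bloch 0 0 0)"
proof -
  have "dagger (bloch 0 0 0) = bloch 0 0 0"
    by (simp add: dagger_def vec_eq_iff forall_2 bloch_nth)
  moreover have "cdot v (bloch 0 0 0 *v v) = (1 / 2) *\<^sub>R cdot v v" for v
    by (simp add: cdot_def matrix_vector_mult_def sum_2 bloch_nth scaleR_conv_of_real field_simps)
  ultimately show ?thesis
    by (simp add: density_matrix_def possemidef_iff Re_cdot_self_nonneg trace_def sum_2 bloch_nth)
qed

lemma separable_kron:
  assumes "density_matrix A" "density_matrix B"
  shows "separable (kron A B)"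
  unfolding separable_def
  by (rule exI[of _ 1], rule exI[of _ "\<lambda>_. 1"], rule exI[of _ "\<lambda>_. A"], rule exI[of _ "\<lambda>_. B"])
     (simp add: assms)

lemma kron_maximally_mixed: "kron (bloch 0 0 0) (bloch 0 0 0) = xmat (1 / 4) 0 (1 / 4)"
  unfolding vec_eq_iff forall_prod_2 by (simp add: kron_def bloch_nth)

text \<open>A mixture of the perfectly correlated product states along the first and third axis
  and the perfectly anticorrelated ones along the second.\<close>

lemma separable_xmat:
  fixes a b :: real
  assumes "0 \<le> a" "0 \<le> b" "2 * a + b = 1"
  shows "separable (xmat ((1 + b) / 4) (a / 2) ((1 - b) / 4))"
proof -
  \<comment> \<open>Averaging over both signs of a Bloch vector cancels the linear terms and leaves
    the identity plus a signed Pauli correlation. The opposite vectors in entries 2 and 3 give the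
    minus sign of the \<open>pauli2\<close> term.\<close>
  define p where "p k = [a / 2, a / 2, a / 2, a / 2, b / 2, b / 2] ! k" for k
  define A where "A k = [bloch 1 0 0, bloch (-1) 0 0, bloch 0 1 0, bloch 0 (-1) 0,
    bloch 0 0 1, bloch 0 0 (-1)] ! k" for k
  define B where "B k = [bloch 1 0 0, bloch (-1) 0 0, bloch 0 (-1) 0, bloch 0 1 0,
    bloch 0 0 1, bloch 0 0 (-1)] ! k" for k
  have all6: "(\<forall>k<6. P k) \<longleftrightarrow> P 0 \<and> P 1 \<and> P 2 \<and> P 3 \<and> P 4 \<and> P 5" for P :: "nat \<Rightarrow> bool"
    by (simp add: eval_nat_numeral All_less_Suc) blast
  have sum6: "(\<Sum>k<6. f k) = f 0 + f 1 + f 2 + f 3 + f 4 + f 5"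
    for f :: "nat \<Rightarrow> 'a::comm_monoid_add"
    by (simp add: eval_nat_numeral)
  have "\<forall>k<6. 0 \<le> p k \<and> density_matrix (A k) \<and> density_matrix (B k)"
    unfolding all6 using assms by (simp add: p_def A_def B_def density_matrix_bloch)
  moreover have "(\<Sum>k<6. p k) = 1"
    unfolding sum6 using assms by (simp add: p_def)
  moreover have "xmat ((1 + b) / 4) (a / 2) ((1 - b) / 4) = (\<Sum>k<6. p k *\<^sub>R kron (A k) (B k))"
    using assms unfolding sum6 vec_eq_iff forall_prod_2 by (simp add: p_def A_def B_def kron_def bloch_nth complex_eq_iff
        field_simps)
  ultimately show ?thesis unfolding separable_def by blast
qed

section \<open>The scalar inequality at a later time\<close>

lemma exp_mult_cosh: "exp (- t) * cosh t = (1 + exp (- 2 * t)) / (2 :: real)"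
  by (simp add: cosh_def exp_minus field_simps flip: exp_add)

text \<open>With \<open>q = exp (- 2 * s)\<close> and \<open>exp (- 2 * t) = q * u\<close>, the two
  sides agree at \<open>u = 1\<close>. Their difference has the factor \<open>1 - u\<close>, and the
  cofactor at \<open>u = 1\<close> is \<open>2 * (1 - q^2) > 0\<close>, so \<open>u\<close> close
  enough below 1 works.\<close>

lemma exists_later_time:
  fixes s :: real
  assumes "s > 0"
  obtains t where "t > s"
    "1 + (exp (- 2 * t) / exp (- 2 * s))\<^sup>2 < 2 * ((1 + exp (- 2 * t)) / (1 + exp (- 2 * s)))\<^sup>2"
proof -
  define q where "q = exp (- 2 * s)"
  \<comment> \<open>The midpoint of \<open>q^2\<close> and 1 is an explicit such \<open>u\<close>:
    the cofactor becomes \<open>(1 - q^2) * (2 + (1 - q)^2) / 2\<close>.\<close>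
  define u where "u = (1 + q\<^sup>2) / 2"
  define t where "t = s - ln u / 2"
  have q: "0 < q" "q < 1" using assms by (simp_all add: q_def)
  have q2: "q\<^sup>2 < 1" using q by (simp add: power_less_one_iff)
  have u: "0 < u" "u < 1" using q2 by (simp_all add: u_def add_pos_nonneg)
  have e: "exp (- 2 * t) = q * u"
  proof -
    have "- 2 * t = - 2 * s + ln u" by (simp add: t_def)
    then show ?thesis using u by (simp only: exp_add q_def exp_ln)
  qed
  have "t > s" using u by (simp add: t_def)
  have "0 < (1 - 2 * q - q\<^sup>2) + u * (1 + 2 * q - q\<^sup>2)"
  proof -
    have "(1 - 2 * q - q\<^sup>2) + u * (1 + 2 * q - q\<^sup>2) = (1 - q\<^sup>2) * (3 - 2 * q + q\<^sup>2) / 2"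
      by (simp add: u_def power2_eq_square field_simps)
    moreover have "0 < (1 - q\<^sup>2) * (3 - 2 * q + q\<^sup>2) / 2"
      using q q2 by (simp add: add_pos_nonneg)
    ultimately show ?thesis by simp
  qed
  then have "0 < (1 - u) * ((1 - 2 * q - q\<^sup>2) + u * (1 + 2 * q - q\<^sup>2))"
    using u by simp
  also have "\<dots> = 2 * (1 + q * u)\<^sup>2 - (1 + u\<^sup>2) * (1 + q)\<^sup>2"
    by (simp add: power2_eq_square algebra_simps)
  finally have "1 + u\<^sup>2 < 2 * ((1 + q * u) / (1 + q))\<^sup>2"
    using q by (simp add: power_divide field_simps)
  then have "1 + (exp (- 2 * t) / exp (- 2 * s))\<^sup>2 < 2 * ((1 + exp (- 2 * t)) / (1 + exp (- 2 * s)))\<^sup>2"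
    using q unfolding e q_def[symmetric] by simp
  then show ?thesis using that \<open>t > s\<close> by simp
qed

section \<open>The Helstrom matrix and its trace norm\<close>

theorem mainTheorem7:
  fixes \<Lambda> :: "real \<Rightarrow> 2 cmat \<Rightarrow> 2 cmat"
  assumes "eternal_pauli_dynamics \<Lambda>"
  shows "\<forall>s>0. \<exists>(\<rho>1 :: (2 \<times> 2) cmat) (\<rho>2 :: (2 \<times> 2) cmat) (\<mu> :: real) (\<alpha> :: real).
           density_matrix \<rho>1 \<and> separable \<rho>1 \<and> density_matrix \<rho>2 \<and> separable \<rho>2 \<and>
           0 < \<mu> \<and> \<mu> < 1 \<and> 0 < \<alpha> \<and>
           tensor_map (\<Lambda> s) (\<Lambda> s) (helstrom \<mu> \<rho>1 \<rho>2) = \<alpha> *\<^sub>R P2plus \<and>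
           (\<exists>t>s. trace_norm (tensor_map (\<Lambda> t) (\<Lambda> t) (helstrom \<mu> \<rho>1 \<rho>2)) >
                  trace_norm (tensor_map (\<Lambda> s) (\<Lambda> s) (helstrom \<mu> \<rho>1 \<rho>2)))"
proof (intro allI impI)
  fix s :: real
  assume s: "s > 0"
  define k where "k t = exp (- 2 * t)" for t :: real
  define l where "l t = exp (- t) * cosh t" for t :: real
  have l_eq: "l t = (1 + k t) / 2" for t by (simp add: l_def k_def exp_mult_cosh)
  have k_pos: "0 < k t" for t by (simp add: k_def)
  have l_pos: "0 < l t" for t using k_pos[of t] by (simp add: l_eq)
  have evol: "tensor_map (\<Lambda> t) (\<Lambda> t) (xmat p q r) =
      xmat ((p + r + (k t)\<^sup>2 * (p - r)) / 2) ((l t)\<^sup>2 * q) ((p + r - (k t)\<^sup>2 * (p - r)) / 2)"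
    if "0 \<le> t" for t p q r
    by (rule tensor_map_xmat)
       (use assms that in \<open>auto simp: eternal_pauli_dynamics_def k_def l_def\<close>)
  define a where "a = 1 / (l s)\<^sup>2"
  define b where "b = 1 / (k s)\<^sup>2"
  have ks: "k s < 1" using s by (simp add: k_def)
  have ab: "0 < a" "0 < b" using k_pos[of s] l_pos[of s] by (simp_all add: a_def b_def)
  have b1: "1 < b"
    using k_pos[of s] ks by (simp add: b_def power_less_one_iff)
  \<comment> \<open>Dividing by \<open>c\<close> turns \<open>a, a, b\<close> into convex weights.
    Comparing traces at time \<open>s\<close> requires \<open>2 * \<mu> - 1 = \<alpha>\<close>; with
    \<open>\<mu> = \<alpha> * c\<close> this fixes \<open>\<alpha>\<close>. Since
    \<open>c > 1\<close>, the weight \<open>1 - \<mu>\<close> is positive.\<close>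
  define c where "c = 2 * a + b"
  define \<alpha> where "\<alpha> = 1 / (2 * c - 1)"
  define \<mu> where "\<mu> = \<alpha> * c"
  have c: "1 < c" using ab b1 by (simp add: c_def)
  have \<alpha>: "0 < \<alpha>" using c by (simp add: \<alpha>_def)
  have \<mu>: "0 < \<mu>" "\<mu> < 1" using c by (simp_all add: \<mu>_def \<alpha>_def)
  have \<mu>': "1 - \<mu> = \<alpha> * (c - 1)" using c by (simp add: \<mu>_def \<alpha>_def field_simps)
  define \<rho>1 where "\<rho>1 = xmat ((1 + b / c) / 4) (a / c / 2) ((1 - b / c) / 4)"
  define \<rho>2 where "\<rho>2 = xmat (1 / 4) 0 (1 / 4)"
  have "2 * (a / c) + b / c = 1" using c by (simp add: c_def add_divide_distrib[symmetric])
  then have sep1: "separable \<rho>1"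
    unfolding \<rho>1_def using ab c by (intro separable_xmat) auto
  have bc: "b / c \<le> 1" using ab c by (simp add: c_def)
  have ac: "a / c / 2 \<le> (1 + b / c) / 4" using ab c by (simp add: c_def field_simps)
  have dens1: "density_matrix \<rho>1"
    unfolding \<rho>1_def density_matrix_def
    using ab c bc ac by (auto intro!: possemidef_xmat simp: trace_xmat field_simps)
  have dens2: "density_matrix \<rho>2"
    by (simp add: density_matrix_def \<rho>2_def possemidef_xmat trace_xmat)
  have sep2: "separable \<rho>2"
    using separable_kron[OF density_matrix_maximally_mixed density_matrix_maximally_mixed]
    by (simp add: kron_maximally_mixed \<rho>2_def)
  \<comment> \<open>The factor \<open>\<mu> = \<alpha> * c\<close> undoes the normalisation by
    \<open>c\<close>, and subtracting \<open>\<alpha> * (c - 1)\<close> times the mixed state leaves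
    identity coefficient \<open>\<alpha> / 4\<close>.\<close>
  have hel: "helstrom \<mu> \<rho>1 \<rho>2 = xmat (\<alpha> * (1 + b) / 4) (\<alpha> * a / 2) (\<alpha> * (1 - b) / 4)"
  proof -
    have "\<mu> * ((1 + b / c) / 4) - (1 - \<mu>) * (1 / 4) = \<alpha> * (1 + b) / 4"
      "\<mu> * (a / c / 2) = \<alpha> * a / 2"
      "\<mu> * ((1 - b / c) / 4) - (1 - \<mu>) * (1 / 4) = \<alpha> * (1 - b) / 4"
      unfolding \<mu>' using c by (simp_all add: \<mu>_def field_simps)
    then show ?thesis
      by (simp only: helstrom_def \<rho>1_def \<rho>2_def scaleR_xmat xmat_diff mult_zero_right diff_zero)
  qed
  have at: "tensor_map (\<Lambda> t) (\<Lambda> t) (helstrom \<mu> \<rho>1 \<rho>2) =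
      xmat (\<alpha> * (1 + (k t / k s)\<^sup>2) / 4) (\<alpha> * (l t / l s)\<^sup>2 / 2) (\<alpha> * (1 - (k t / k s)\<^sup>2) / 4)"
    if "0 \<le> t" for t
  proof -
    have "\<alpha> * (1 + b) / 4 + \<alpha> * (1 - b) / 4 = \<alpha> / 2" "\<alpha> * (1 + b) / 4 - \<alpha> * (1 - b) / 4 = \<alpha> * b / 2"
      by (simp_all add: field_simps)
    moreover have "(\<alpha> / 2 + (k t)\<^sup>2 * (\<alpha> * b / 2)) / 2 = \<alpha> * (1 + (k t / k s)\<^sup>2) / 4"
      "(\<alpha> / 2 - (k t)\<^sup>2 * (\<alpha> * b / 2)) / 2 = \<alpha> * (1 - (k t / k s)\<^sup>2) / 4"
      "(l t)\<^sup>2 * (\<alpha> * a / 2) = \<alpha> * (l t / l s)\<^sup>2 / 2"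
      using k_pos[of s] l_pos[of s] by (simp_all add: a_def b_def field_simps)
    ultimately show ?thesis
      by (simp only: hel evol[OF that])
  qed
  have at_s: "tensor_map (\<Lambda> s) (\<Lambda> s) (helstrom \<mu> \<rho>1 \<rho>2) = xmat (\<alpha> / 2) (\<alpha> / 2) 0"
    using at[of s] s k_pos[of s] l_pos[of s] by simp
  then have proj: "tensor_map (\<Lambda> s) (\<Lambda> s) (helstrom \<mu> \<rho>1 \<rho>2) = \<alpha> *\<^sub>R P2plus"
    by (simp add: P2plus_eq_xmat scaleR_xmat)
  obtain t where t: "t > s" "1 + (k t / k s)\<^sup>2 < 2 * ((1 + k t) / (1 + k s))\<^sup>2"
    using exists_later_time[OF s] unfolding k_def by metis
  define x where "x = (l t / l s)\<^sup>2"
  define z where "z = (k t / k s)\<^sup>2"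
  have xz: "1 + z < 2 * x"
  proof -
    have "l t / l s = (1 + k t) / (1 + k s)"
      using k_pos[of s] by (simp add: l_eq field_simps)
    then show ?thesis using t(2) by (simp add: x_def z_def)
  qed
  \<comment> \<open>The bound \<open>z \<le> 1\<close> keeps the inner eigenvalue
    \<open>\<alpha> * (1 - z) / 4\<close> nonnegative, as \<open>trace_norm_xmat\<close>
    requires.\<close>
  have z: "0 \<le> z" "z \<le> 1"
  proof -
    have "0 \<le> k t / k s" "k t / k s \<le> 1"
      using t(1) k_pos[of t] k_pos[of s] by (simp_all add: k_def)
    then show "0 \<le> z" "z \<le> 1" unfolding z_def by (simp_all add: power_le_one)
  qed
  have norm_s: "trace_norm (tensor_map (\<Lambda> s) (\<Lambda> s) (helstrom \<mu> \<rho>1 \<rho>2)) = \<alpha>"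
    unfolding at_s using \<alpha> by (subst trace_norm_xmat) auto
  have "trace_norm (tensor_map (\<Lambda> t) (\<Lambda> t) (helstrom \<mu> \<rho>1 \<rho>2)) = \<alpha> * (x + (1 - z) / 2)"
  proof -
    have "\<alpha> * (1 + z) \<le> \<alpha> * (2 * x)" using xz \<alpha> by simp
    then have "\<bar>\<alpha> * (1 + z) / 4\<bar> \<le> \<alpha> * x / 2" using \<alpha> z by simp
    moreover have "0 \<le> \<alpha> * (1 - z) / 4" using \<alpha> z by simp
    moreover have "0 \<le> t" using s t by simp
    ultimately show ?thesis
      unfolding at[OF \<open>0 \<le> t\<close>] x_def[symmetric] z_def[symmetric]
      by (simp add: trace_norm_xmat) (simp add: field_simps)
  qed
  \<comment> \<open>The excess over \<open>\<alpha>\<close> is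
    \<open>\<alpha> * (2 * x - 1 - z) / 2\<close>, twice the modulus of the negative
    eigenvalue.\<close>
  also have "\<alpha> * (x + (1 - z) / 2) > \<alpha> * 1"
    using xz \<alpha> by (intro mult_strict_left_mono) (simp_all add: field_simps)
  finally have "\<exists>t>s. trace_norm (tensor_map (\<Lambda> t) (\<Lambda> t) (helstrom \<mu> \<rho>1 \<rho>2)) >
                  trace_norm (tensor_map (\<Lambda> s) (\<Lambda> s) (helstrom \<mu> \<rho>1 \<rho>2))"
    using t(1) norm_s by auto
  with dens1 sep1 dens2 sep2 \<mu> \<alpha> proj
  show "\<exists>\<rho>1 \<rho>2 \<mu> \<alpha>. density_matrix \<rho>1 \<and> separable \<rho>1 \<and> density_matrix \<rho>2 \<and> separable \<rho>2 \<and>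
           0 < \<mu> \<and> \<mu> < 1 \<and> 0 < \<alpha> \<and>
           tensor_map (\<Lambda> s) (\<Lambda> s) (helstrom \<mu> \<rho>1 \<rho>2) = \<alpha> *\<^sub>R P2plus \<and>
           (\<exists>t>s. trace_norm (tensor_map (\<Lambda> t) (\<Lambda> t) (helstrom \<mu> \<rho>1 \<rho>2)) >
                  trace_norm (tensor_map (\<Lambda> s) (\<Lambda> s) (helstrom \<mu> \<rho>1 \<rho>2)))"
    by blast
qed

end
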